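(* Let $m$ be a positive integer, let $d\ge 1$ be a real number, and let $P(x)$ be a monic real polynomial of degree $m$ whose coefficients are nonnegative and non-decreasing. Put $\overline m=\left\lceil \frac{m-d}{d+1}\right\rceil$. Then $P(x+d)$ has at most two modes: if $P(x)=x^m$, every mode of $P(x+d)$ is one of $\overline m$ and $\overline m+1$; if $P(x)\neq x^m$, every mode of $P(x+d)$ is one of $\overline m-1$ and $\overline m$.
   Context: Coefficients of a polynomial $\sum_{i=0}^m a_ix^i$ are called non-decreasing if $a_0\le a_1\le\cdots\le a_m$. A sequence $b_0,\ldots,b_m$ of nonnegative real numbers is unimodal if there is an index $0\le t\le m$ with $b_0\le\cdots\le b_{t-1}\le b_t\ge b_{t+1}\ge\cdots\ge b_m$; any such index $t$ is called a mode of the sequence. A mode of a polynomial $\sum_{j=0}^m b_jx^j$ with nonnegative coefficients is a mode of its coefficient sequence $b_0,\ldots,b_m$. *)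

theory Defs
  imports Complex_Main "HOL-Computational_Algebra.Polynomial"
begin

definition nondecreasing_coeffs :: "real poly \<Rightarrow> bool" where
  "nondecreasing_coeffs p \<longleftrightarrow>
     (\<forall>i j. i \<le> j \<and> j \<le> degree p \<longrightarrow> coeff p i \<le> coeff p j)"

(* A mode t of the finite sequence b 0, ..., b m; values b j with j > m are irrelevant.
   The sequence is unimodal iff such a t exists.  Nonnegativity of b is a standing
   assumption on the sequences considered and not part of the condition on t. *)
definition is_mode :: "(nat \<Rightarrow> real) \<Rightarrow> nat \<Rightarrow> nat \<Rightarrow> bool" where
  "is_mode b m t \<longleftrightarrow>
     t \<le> m \<and> (\<forall>j<t. b j \<le> b (Suc j)) \<and> (\<forall>j. t \<le> j \<and> j < m \<longrightarrow> b j \<ge> b (Suc j))"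

definition modes :: "real poly \<Rightarrow> nat set" where
  "modes p = {t. is_mode (coeff p) (degree p) t}"

definition shift_poly :: "real \<Rightarrow> real poly \<Rightarrow> real poly" where
  "shift_poly d p = pcompose p [:d, 1:]"

end

theory Submission
  imports Defs
begin

text \<open>
  Write \<open>P = \<Sum> a\<^sub>i x\<^sup>i\<close> and let \<open>rise d i j\<close> be the step from coefficient \<open>j\<close> to coefficient
  \<open>j + 1\<close> of \<open>(x + d)\<^sup>i\<close>. The corresponding step of \<open>P (x + d)\<close> is \<open>\<Sum> a\<^sub>i * rise d i j\<close>, so the
  modes are located by the signs of these sums. For a single power the sign is explicit:
  \<open>rise d i j\<close> has the sign of \<open>(i + 1) - (j + 1) (d + 1)\<close> for \<open>j \<le> i\<close>.

  To the right of the claimed modes no argument is needed beyond this: if \<open>rise d m j \<le> 0\<close> then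
  \<open>rise d i j \<le> 0\<close> for all \<open>i \<le> m\<close>, so \<open>P (x + d)\<close> descends at \<open>j\<close>. If \<open>P\<close> is not \<open>x\<^sup>m\<close>, then
  monotonicity of the coefficients gives \<open>a\<^sub>m\<^sub>-\<^sub>1 > 0\<close>, and the summand \<open>i = m - 1\<close> makes the descent
  strict even where \<open>rise d m j = 0\<close>. For \<open>x\<^sup>m\<close> itself such an equality is possible, which is
  why its upper bound on the modes is larger by one.

  To the left, the summands with small \<open>i\<close> are negative, and one has to see that they are outweighed
  as soon as \<open>rise d m (j + 1) > 0\<close>, that is, when \<open>(x + d)\<^sup>m\<close> still ascends one index later.
  This shift by one is the \<open>- 1\<close> in the lower bound. Pascal's rule gives
  \<open>rise d (i + 1) (j + 1) = d * rise d i (j + 1) + rise d i j\<close>. Since \<open>d \<ge> 1\<close>, as long as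
  \<open>rise d i (j + 1) \<le> 0\<close> the increment of \<open>rise d i (j + 1)\<close> in \<open>i\<close> is at most \<open>rise d i j\<close>.
  Summing this, with the non-decreasing weights \<open>a\<^sub>i\<close>, shows that the partial sums of
  \<open>a\<^sub>i * rise d i j\<close> stay above \<open>a\<^sub>k * rise d k (j + 1)\<close> until the latter becomes
  positive; from then on every new summand is nonnegative. This is
  \<open>weighted_rise_partial_sum_ge\<close>.
\<close>

section \<open>Coefficient steps of a power of a linear polynomial\<close>

definition rise :: "real \<Rightarrow> nat \<Rightarrow> nat \<Rightarrow> real" where
  "rise d i j = coeff ([:d, 1:] ^ i) (Suc j) - coeff ([:d, 1:] ^ i) j"

lemma coeff_linear_power_Suc_Suc:
  "coeff ([:d, 1:] ^ Suc i) (Suc j) = d * coeff ([:d, 1:] ^ i) (Suc j) + coeff ([:d, 1:] ^ i) j"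
  for d :: real
  by simp

lemma coeff_linear_power_Suc_0:
  "coeff ([:d, 1:] ^ Suc i) 0 = d * coeff ([:d, 1:] ^ i) 0" for d :: real
  by simp

lemma rise_Suc_Suc: "rise d (Suc i) (Suc j) = d * rise d i (Suc j) + rise d i j"
  unfolding rise_def coeff_linear_power_Suc_Suc by (simp add: algebra_simps)

text \<open>
  The ratio of consecutive coefficients of \<open>(x + d)\<^sup>i\<close>, cleared of denominators; in this form
  it also holds for \<open>j > i\<close>, where both sides vanish.
\<close>

lemma coeff_linear_power_ratio:
  "d * (real j + 1) * coeff ([:d, 1:] ^ i) (Suc j) = (real i - real j) * coeff ([:d, 1:] ^ i) j"
  for d :: real
proof (induction i arbitrary: j)
  case 0
  show ?case by (cases j) auto
next
  case (Suc i)
  show ?case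
  proof (cases j)
    case 0
    have "d * coeff ([:d, 1:] ^ i) (Suc 0) = real i * coeff ([:d, 1:] ^ i) 0"
      using Suc.IH[of 0] by simp
    then show ?thesis
      unfolding 0 coeff_linear_power_Suc_Suc coeff_linear_power_Suc_0 by (simp add: algebra_simps)
  next
    case (Suc l)
    define x y z where "x = coeff ([:d, 1:] ^ i) (Suc (Suc l))"
      and "y = coeff ([:d, 1:] ^ i) (Suc l)" and "z = coeff ([:d, 1:] ^ i) l"
    have upper: "d * (real l + 2) * x = (real i - real l - 1) * y"
      and lower: "d * (real l + 1) * y = (real i - real l) * z"
      using Suc.IH[of "Suc l"] Suc.IH[of l] by (simp_all add: x_def y_def z_def algebra_simps)
    have "d * (real l + 2) * (d * x + y) = d * (d * (real l + 2) * x) + d * (real l + 2) * y"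
      by (simp add: algebra_simps)
    also have "\<dots> = (real i - real l) * (d * y) + d * (real l + 1) * y"
      unfolding upper by (simp add: algebra_simps)
    also have "\<dots> = (real i - real l) * (d * y + z)"
      unfolding lower by (simp add: algebra_simps)
    finally show ?thesis
      unfolding Suc coeff_linear_power_Suc_Suc x_def y_def z_def by (simp add: algebra_simps)
  qed
qed

lemma coeff_linear_power_pos:
  "d > 0 \<Longrightarrow> j \<le> i \<Longrightarrow> coeff ([:d, 1:] ^ i) j > 0" for d :: real
  by (simp add: coeff_linear_poly_power)

lemma coeff_linear_power_nonneg:
  "d > 0 \<Longrightarrow> coeff ([:d, 1:] ^ i) j \<ge> 0" for d :: real
  by (cases "j \<le> i")
    (auto simp: coeff_linear_poly_power coeff_eq_0 degree_linear_power)

lemma rise_sign_formula: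
  "d * (real j + 1) * rise d i j
     = coeff ([:d, 1:] ^ i) j * (real i + 1 - (real j + 1) * (d + 1))"
  using coeff_linear_power_ratio[of d j i] by (simp add: rise_def algebra_simps)

lemma rise_pos:
  assumes "d > 0" "j \<le> i" "(real j + 1) * (d + 1) < real i + 1"
  shows "rise d i j > 0"
proof -
  have "d * (real j + 1) * rise d i j > 0"
    unfolding rise_sign_formula using assms by (simp add: coeff_linear_power_pos)
  then show ?thesis
    by (rule zero_less_mult_pos) (use assms(1) in simp)
qed

lemma rise_neg:
  assumes "d > 0" "j \<le> i" "real i + 1 < (real j + 1) * (d + 1)"
  shows "rise d i j < 0"
proof -
  have "d * (real j + 1) * rise d i j < 0"
    unfolding rise_sign_formula using assms by (simp add: coeff_linear_power_pos mult_pos_neg)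
  then show ?thesis
    using assms(1) by (smt (verit) mult_nonneg_nonneg of_nat_0_le_iff)
qed

lemma rise_nonpos:
  assumes "d > 0" "real i + 1 \<le> (real j + 1) * (d + 1)"
  shows "rise d i j \<le> 0"
proof -
  have "d * (real j + 1) * rise d i j \<le> 0"
    unfolding rise_sign_formula using assms
    by (simp add: coeff_linear_power_nonneg mult_nonneg_nonpos)
  then show ?thesis
    using assms(1) by (smt (verit) mult_pos_pos of_nat_0_le_iff)
qed

lemma rise_pos_of_rise_Suc_pos:
  assumes "d > 0" "rise d i (Suc j) > 0"
  shows "rise d i j > 0"
proof (rule rise_pos)
  have bound: "(real (Suc j) + 1) * (d + 1) < real i + 1"
    using rise_nonpos[of d i "Suc j"] assms by linarith
  have step: "(real (Suc j) + 1) * (d + 1) = (real j + 1) * (d + 1) + (d + 1)"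
    by (simp add: algebra_simps)
  show "(real j + 1) * (d + 1) < real i + 1"
    using bound step assms(1) by linarith
  then have "(real j + 1) * 1 < real i + 1"
    using assms(1) mult_left_mono[of 1 "d + 1" "real j + 1"] by linarith
  then show "j \<le> i"
    by simp
qed (use assms in simp)

section \<open>Non-decreasing combinations of the steps\<close>

text \<open>
  The minimum with \<open>0\<close> joins the two regimes. While \<open>rise d k (j + 1) \<le> 0\<close>, Pascal's rule and
  \<open>d \<ge> 1\<close> bound its growth by \<open>rise d k j\<close>, and replacing \<open>a k\<close> by the larger \<open>a (k + 1)\<close> only
  lowers a nonpositive bound. Once \<open>rise d k (j + 1) > 0\<close>, also \<open>rise d k j > 0\<close>, so the sum
  cannot decrease.
\<close>

lemma weighted_rise_partial_sum_ge:
  assumes "d \<ge> 1" and nonneg: "\<And>i. a i \<ge> 0"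
    and mono: "\<And>i. i < m \<Longrightarrow> a i \<le> a (Suc i)" and "k \<le> m"
  shows "(\<Sum>i<k. a i * rise d i j) \<ge> min 0 (a k * rise d k (Suc j))"
  using \<open>k \<le> m\<close>
proof (induction k)
  case 0
  show ?case by simp
next
  case (Suc k)
  let ?S = "\<Sum>i<k. a i * rise d i j" and ?r = "rise d k (Suc j)"
  have IH: "?S \<ge> min 0 (a k * ?r)"
    using Suc by simp
  show ?case
  proof (cases "?r > 0")
    case True
    then have "a k * rise d k j \<ge> 0"
      using rise_pos_of_rise_Suc_pos[of d k j] assms(1) nonneg[of k] by simp
    moreover have "?S \<ge> 0"
      using IH True nonneg[of k] by simp
    ultimately show ?thesis
      by simp
  next
    case False
    then have "?S \<ge> a k * ?r"
      using IH nonneg[of k] by (simp add: mult_nonneg_nonpos)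
    moreover have "a k * rise d (Suc k) (Suc j) \<le> a k * (?r + rise d k j)"
    proof (intro mult_left_mono nonneg)
      have "d * ?r \<le> 1 * ?r"
        using False assms(1) by (intro mult_right_mono_neg) auto
      then show "rise d (Suc k) (Suc j) \<le> ?r + rise d k j"
        unfolding rise_Suc_Suc by simp
    qed
    ultimately have bound: "(\<Sum>i<Suc k. a i * rise d i j) \<ge> a k * rise d (Suc k) (Suc j)"
      by (simp add: distrib_left)
    show ?thesis
    proof (cases "rise d (Suc k) (Suc j) \<ge> 0")
      case True
      then have "0 \<le> a k * rise d (Suc k) (Suc j)"
        using nonneg[of k] by simp
      then show ?thesis
        using bound by linarith
    next
      case False
      then have "a (Suc k) * rise d (Suc k) (Suc j) \<le> a k * rise d (Suc k) (Suc j)"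
        using mono[of k] Suc.prems by (intro mult_right_mono_neg) auto
      then show ?thesis
        using bound by linarith
    qed
  qed
qed

section \<open>Ascents and descents of the shifted polynomial\<close>

lemma coeff_shift_poly:
  "coeff (shift_poly d P) j = (\<Sum>i\<le>degree P. coeff P i * coeff ([:d, 1:] ^ i) j)"
  by (simp add: shift_poly_def pcompose_altdef poly_altdef coeff_sum degree_map_poly coeff_map_poly)

lemma coeff_shift_poly_step:
  "coeff (shift_poly d P) (Suc j) - coeff (shift_poly d P) j
     = (\<Sum>i\<le>degree P. coeff P i * rise d i j)"
  by (simp add: coeff_shift_poly rise_def sum_subtractf right_diff_distrib)

lemma degree_shift_poly: "degree (shift_poly d P) = degree P"
  by (simp add: shift_poly_def degree_pcompose)

lemma shift_poly_ascends:
  assumes "d \<ge> 1" and nonneg: "\<forall>i. coeff P i \<ge> 0" and mono: "nondecreasing_coeffs P"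
    and "lead_coeff P > 0" and "Suc j \<le> degree P"
    and "(real j + 2) * (d + 1) < real (degree P) + 1"
  shows "coeff (shift_poly d P) j < coeff (shift_poly d P) (Suc j)"
proof -
  let ?m = "degree P"
  have next_pos: "rise d ?m (Suc j) > 0"
    using assms by (intro rise_pos) (auto simp: algebra_simps)
  have "(\<Sum>i<?m. coeff P i * rise d i j) \<ge> min 0 (lead_coeff P * rise d ?m (Suc j))"
    using assms by (intro weighted_rise_partial_sum_ge[where m = ?m])
      (auto simp: nondecreasing_coeffs_def)
  moreover have "lead_coeff P * rise d ?m (Suc j) > 0"
    using next_pos assms(4) by simp
  moreover have "lead_coeff P * rise d ?m j > 0"
    using rise_pos_of_rise_Suc_pos[OF _ next_pos] assms(1,4) by simp
  ultimately have "(\<Sum>i\<le>?m. coeff P i * rise d i j) > 0"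
    by (simp add: lessThan_Suc_atMost[symmetric])
  then show ?thesis
    using coeff_shift_poly_step[of d P j] by linarith
qed

text \<open>
  The witness for strictness is a nonzero coefficient of index \<open>i\<close> in the range where
  \<open>(x + d)\<^sup>i\<close> itself descends strictly at \<open>j\<close>.
\<close>

lemma shift_poly_descends:
  assumes "d > 0" and nonneg: "\<forall>i. coeff P i \<ge> 0"
    and "real (degree P) + 1 \<le> (real j + 1) * (d + 1)"
    and "coeff P i > 0" "j \<le> i" "i \<le> degree P" "real i + 1 < (real j + 1) * (d + 1)"
  shows "coeff (shift_poly d P) (Suc j) < coeff (shift_poly d P) j"
proof -
  have "(\<Sum>l\<le>degree P. coeff P l * rise d l j) < (\<Sum>l\<le>degree P. 0)"
  proof (rule sum_strict_mono_ex1)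
    have "rise d l j \<le> 0" if "l \<le> degree P" for l
      using assms that by (intro rise_nonpos) auto
    then show "\<forall>l\<in>{..degree P}. coeff P l * rise d l j \<le> 0"
      using nonneg by (simp add: mult_nonneg_nonpos)
    have "coeff P i * rise d i j < 0"
      using rise_neg[of d j i] assms by (simp add: mult_pos_neg)
    then show "\<exists>l\<in>{..degree P}. coeff P l * rise d l j < 0"
      using assms by auto
  qed simp
  then show ?thesis
    using coeff_shift_poly_step[of d P j] by simp
qed

lemma shift_monom_ascends:
  assumes "d > 0" "j \<le> m" "(real j + 1) * (d + 1) < real m + 1"
  shows "coeff (shift_poly d (monom 1 m)) j < coeff (shift_poly d (monom 1 m)) (Suc j)"
proof -
  have "coeff (shift_poly d (monom 1 m)) (Suc j) - coeff (shift_poly d (monom 1 m)) j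
      = (\<Sum>i\<le>m. if i = m then rise d i j else 0)"
    unfolding coeff_shift_poly_step by (intro sum.cong) (auto simp: degree_monom_eq)
  also have "\<dots> = rise d m j"
    by simp
  finally show ?thesis
    using rise_pos[OF assms] by linarith
qed

lemma subleading_coeff_pos:
  assumes "lead_coeff P = 1" "\<forall>i. coeff P i \<ge> 0" "nondecreasing_coeffs P"
    and "P \<noteq> monom 1 (degree P)"
  shows "coeff P (degree P - 1) > 0"
proof (rule ccontr)
  assume "\<not> coeff P (degree P - 1) > 0"
  then have zero: "coeff P (degree P - 1) = 0"
    using assms(2) by (simp add: order.antisym not_less)
  have "coeff P i = coeff (monom 1 (degree P)) i" for i
  proof -
    consider "i < degree P" | "i = degree P" | "i > degree P"
      by linarith
    then show ?thesis
    proof cases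
      case 1
      then have "coeff P i \<le> coeff P (degree P - 1)"
        using assms(3) by (auto simp: nondecreasing_coeffs_def)
      then show ?thesis
        using 1 zero assms(2) by (auto intro: order.antisym)
    qed (use assms(1) in \<open>auto simp: coeff_eq_0\<close>)
  qed
  then show False
    using assms(4) poly_eqI by blast
qed

section \<open>Location of the modes\<close>

lemma mode_not_ascending:
  "t \<in> modes p \<Longrightarrow> t < degree p \<Longrightarrow> coeff p (Suc t) \<le> coeff p t"
  by (auto simp: modes_def is_mode_def)

lemma mode_not_preceded_by_descent:
  "t \<in> modes p \<Longrightarrow> t = Suc j \<Longrightarrow> coeff p j \<le> coeff p (Suc j)"
  by (auto simp: modes_def is_mode_def)

lemma card_le_2_of_int_image:
  assumes "\<forall>t\<in>A. int t \<in> {a, b}"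
  shows "card A \<le> 2"
proof -
  have "card A = card (int ` A)"
    by (simp add: card_image)
  also have "\<dots> \<le> card {a, b}"
    using assms by (intro card_mono) auto
  also have "\<dots> \<le> 2"
    by (simp add: card_insert_if)
  finally show ?thesis .
qed

theorem corollary4p1:
  fixes m :: nat and d :: real and P :: "real poly" and mbar :: int
  assumes "m \<ge> 1"
    and "d \<ge> 1"
    and "degree P = m"
    and "lead_coeff P = 1"
    and "\<forall>i. coeff P i \<ge> 0"
    and "nondecreasing_coeffs P"
    and "mbar = \<lceil>(real m - d) / (d + 1)\<rceil>"
  shows "card (modes (shift_poly d P)) \<le> 2
    \<and> (P = monom 1 m \<longrightarrow> (\<forall>t \<in> modes (shift_poly d P). int t \<in> {mbar, mbar + 1}))
    \<and> (P \<noteq> monom 1 m \<longrightarrow> (\<forall>t \<in> modes (shift_poly d P). int t \<in> {mbar - 1, mbar}))"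
proof -
  let ?Q = "shift_poly d P" and ?x = "(real m - d) / (d + 1)"
  have d: "d > 0" "d + 1 > 0"
    using assms(2) by auto
  have threshold_less: "y < ?x \<longleftrightarrow> (y + 1) * (d + 1) < real m + 1" for y
    using d by (simp add: field_simps)
  have threshold_ge: "?x \<le> y \<longleftrightarrow> real m + 1 \<le> (y + 1) * (d + 1)" for y
    using threshold_less[of y] by linarith
  have x_less: "of_int k < ?x" if "k < mbar" for k
    using that unfolding assms(7) less_ceiling_iff .
  have x_le: "?x \<le> of_int mbar"
    using assms(7) by simp
  have "0 \<le> real m * d"
    using d by simp
  then have "?x < real m"
    using d by (simp add: field_simps add_pos_nonneg)
  have "-1 < ?x"
    using d by (simp add: field_simps)
  then have "mbar \<ge> 0"
    using x_le by linarith
  have monom_modes: "int t \<in> {mbar, mbar + 1}" if P: "P = monom 1 m" and t: "t \<in> modes ?Q" for t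
  proof -
    have "mbar \<le> int t"
    proof (rule ccontr)
      assume "\<not> mbar \<le> int t"
      then have "real t < ?x"
        using x_less[of "int t"] by (simp only: not_le of_int_of_nat_eq)
      then have "t < m" "(real t + 1) * (d + 1) < real m + 1"
        using \<open>?x < real m\<close> threshold_less[of "real t"] by linarith+
      then have "coeff ?Q t < coeff ?Q (Suc t)"
        using shift_monom_ascends[of d t m] d(1) unfolding P by simp
      then show False
        using mode_not_ascending[OF t] assms(3) \<open>t < m\<close> by (simp add: degree_shift_poly)
    qed
    moreover have "int t \<le> mbar + 1"
    proof (rule ccontr)
      assume far: "\<not> int t \<le> mbar + 1"
      then obtain j where j: "t = Suc j"
        using \<open>mbar \<ge> 0\<close> by (cases t) auto
      have "j < m"
        using t j assms(3) by (simp add: modes_def is_mode_def degree_shift_poly)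
      have "?x < real j"
        using far j x_le by linarith
      then have "real m + 1 < (real j + 1) * (d + 1)"
        unfolding pos_divide_less_eq[OF d(2)] by (simp add: algebra_simps)
      then have "coeff ?Q (Suc j) < coeff ?Q j"
        using d assms \<open>j < m\<close> by (intro shift_poly_descends[where i = m]) auto
      then show False
        using mode_not_preceded_by_descent[OF t j] by simp
    qed
    ultimately show ?thesis
      by auto
  qed
  have other_modes: "int t \<in> {mbar - 1, mbar}" if P: "P \<noteq> monom 1 m" and t: "t \<in> modes ?Q" for t
  proof -
    have "mbar - 1 \<le> int t"
    proof (rule ccontr)
      assume "\<not> mbar - 1 \<le> int t"
      then have "int t + 1 < mbar"
        by linarith
      then have "real t + 1 < ?x"
        using x_less[of "int t + 1"] by (simp only: not_le of_int_of_nat_eq of_int_add of_int_1)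
      then have "(real t + 2) * (d + 1) < real m + 1"
        using threshold_less[of "real t + 1"] by (simp only: add.assoc one_add_one)
      moreover have "Suc t \<le> m"
        using \<open>real t + 1 < ?x\<close> \<open>?x < real m\<close> by linarith
      ultimately have "coeff ?Q t < coeff ?Q (Suc t)"
        using assms by (intro shift_poly_ascends) auto
      then show False
        using mode_not_ascending[OF t] \<open>Suc t \<le> m\<close> assms(3) by (simp add: degree_shift_poly)
    qed
    moreover have "int t \<le> mbar"
    proof (rule ccontr)
      assume far: "\<not> int t \<le> mbar"
      then obtain j where j: "t = Suc j"
        using \<open>mbar \<ge> 0\<close> by (cases t) auto
      have "j < m"
        using t j assms(3) by (simp add: modes_def is_mode_def degree_shift_poly)
      have "?x \<le> real j"
        using far j x_le by linarith
      then have "real m + 1 \<le> (real j + 1) * (d + 1)"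
        using threshold_ge by blast
      moreover have "coeff P (m - 1) > 0"
        using subleading_coeff_pos[of P] assms P by simp
      ultimately have "coeff ?Q (Suc j) < coeff ?Q j"
        using d assms \<open>j < m\<close> by (intro shift_poly_descends[where i = "m - 1"]) auto
      then show False
        using mode_not_preceded_by_descent[OF t j] by simp
    qed
    ultimately show ?thesis
      by auto
  qed
  have "card (modes ?Q) \<le> 2"
  proof (cases "P = monom 1 m")
    case True
    show ?thesis
      by (rule card_le_2_of_int_image[of _ mbar "mbar + 1"]) (intro ballI monom_modes[OF True])
  next
    case False
    show ?thesis
      by (rule card_le_2_of_int_image[of _ "mbar - 1" mbar]) (intro ballI other_modes[OF False])
  qed
  then show ?thesis
    by (intro conjI impI ballI monom_modes other_modes)
qed

end
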